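(* Let $X_1,\dots,X_n$ be i.i.d. random variables with the Lindley distribution with parameter $\theta>0$, i.e. with probability density function $f(x)=\frac{\theta^2}{1+\theta}(1+x)e^{-\theta x}$, $x>0$, and cumulative distribution function $F(x)=1-\frac{1+\theta+\theta x}{1+\theta}e^{-\theta x}$, $x>0$. Let $T=\sum_{i=1}^n X_i$, and let $T=t$ be given. Then $$\widehat f(x)=\frac{1+x}{A_n(t)}\sum_{k=0}^{n-1}C_{k,n}(t-x)^{2n-3-k},\qquad 0<x<t,$$ is a uniformly minimum variance unbiased estimator (UMVUE) for $f(x)$, and $$\widehat F(x)=\frac{1}{A_n(t)}\sum_{k=0}^{n-1}C_{k,n}\,t^{2n-2-k}\left[\frac{1}{2n-k-2}I_{x/t}(1,2n-2-k)+t\,\frac{1}{(2n-k-1)(2n-k-2)}I_{x/t}(2,2n-2-k)\right],\qquad 0<x<t,$$ is a UMVUE for $F(x)$, where $$C_{k,n}=\frac{\binom{n-1}{k}}{\Gamma(2n-2-k)},\qquad A_n(t)=\sum_{j=0}^{n}\binom{n}{j}\frac{t^{2n-j-1}}{\Gamma(2n-j)}.$$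
   Context: $I_y(\alpha,\beta)=\frac{1}{B(\alpha,\beta)}\int_0^y u^{\alpha-1}(1-u)^{\beta-1}\,du$ is the (regularized) incomplete beta function, with $B(\alpha,\beta)=\frac{\Gamma(\alpha)\Gamma(\beta)}{\Gamma(\alpha+\beta)}$. The statistic $T$ is a complete sufficient statistic for $\theta$. A UMVUE of a function of $\theta$ is an unbiased estimator of it whose variance is, for every $\theta>0$, no larger than that of any other unbiased estimator. *)

theory Defs
  imports "HOL-Probability.Probability"
begin

definition lindley_pdf :: "real \<Rightarrow> real \<Rightarrow> real" where
  "lindley_pdf \<theta> x = (if x > 0 then \<theta>^2 / (1 + \<theta>) * (1 + x) * exp (- \<theta> * x) else 0)"

definition lindley_cdf :: "real \<Rightarrow> real \<Rightarrow> real" where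
  "lindley_cdf \<theta> x = (if x > 0 then 1 - (1 + \<theta> + \<theta> * x) / (1 + \<theta>) * exp (- \<theta> * x) else 0)"

definition reg_inc_beta :: "real \<Rightarrow> real \<Rightarrow> real \<Rightarrow> real" where
  "reg_inc_beta y \<alpha> \<beta> =
     1 / Beta \<alpha> \<beta> * (LBINT u:{0..y}. u powr (\<alpha> - 1) * (1 - u) powr (\<beta> - 1))"

(* Throughout, n \<ge> 2 and k \<le> n - 1, so that the truncated subtractions in the exponents
   below are genuine and the Gamma function is only evaluated at positive arguments. *)

definition C_coeff :: "nat \<Rightarrow> nat \<Rightarrow> real" where
  "C_coeff k n = real ((n - 1) choose k) / Gamma (2 * real n - 2 - real k)"

definition A_fun :: "nat \<Rightarrow> real \<Rightarrow> real" where
  "A_fun n t = (\<Sum>j=0..n. real (n choose j) * (t ^ (2 * n - j - 1) / Gamma (2 * real n - real j)))"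

(* The two closed forms apply for 0 < x < t only. An estimator has to be defined for every value
   t of the statistic; for t \<le> x it takes the value 0 of the conditional density of X_1 given
   T = t outside (0, t), respectively the value 1 of the conditional distribution function. *)

definition pdf_estimate :: "nat \<Rightarrow> real \<Rightarrow> real \<Rightarrow> real" where
  "pdf_estimate n x t =
     (if x < t
      then (1 + x) / A_fun n t * (\<Sum>k=0..n-1. C_coeff k n * (t - x) ^ (2 * n - 3 - k))
      else 0)"

definition cdf_estimate :: "nat \<Rightarrow> real \<Rightarrow> real \<Rightarrow> real" where
  "cdf_estimate n x t =
     (if x < t
      then 1 / A_fun n t *
        (\<Sum>k=0..n-1. C_coeff k n * t ^ (2 * n - 2 - k) *
          (1 / (2 * real n - real k - 2) * reg_inc_beta (x / t) 1 (2 * real n - 2 - real k)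
           + t * (1 / ((2 * real n - real k - 1) * (2 * real n - real k - 2)))
               * reg_inc_beta (x / t) 2 (2 * real n - 2 - real k)))
      else 1)"

definition sample :: "nat \<Rightarrow> (nat \<Rightarrow> 'a \<Rightarrow> real) \<Rightarrow> 'a \<Rightarrow> (nat \<Rightarrow> real)" where
  "sample n X \<omega> = (\<lambda>i\<in>{1..n}. X i \<omega>)"

(* Extended-valued, so that an estimator without second moment has variance \<infinity>; the library's
   real-valued variance would be 0 in that case. *)
definition evariance :: "'a measure \<Rightarrow> ('a \<Rightarrow> real) \<Rightarrow> ennreal" where
  "evariance M Z = (\<integral>\<^sup>+\<omega>. ennreal ((Z \<omega> - integral\<^sup>L M Z)^2) \<partial>M)"

(* \<Theta> is the parameter set, P \<theta> the probability measure under \<theta>, Y the observed data with values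
   in the measurable space S, and g the function of the parameter to be estimated.
   Estimators are the measurable real functions of the data. *)
definition unbiased_estimator ::
  "'p set \<Rightarrow> ('p \<Rightarrow> 'a measure) \<Rightarrow> ('a \<Rightarrow> 's) \<Rightarrow> 's measure \<Rightarrow> ('p \<Rightarrow> real) \<Rightarrow> ('s \<Rightarrow> real) \<Rightarrow> bool" where
  "unbiased_estimator \<Theta> P Y S g \<delta> \<longleftrightarrow>
     \<delta> \<in> borel_measurable S \<and>
     (\<forall>\<theta>\<in>\<Theta>. integrable (P \<theta>) (\<lambda>\<omega>. \<delta> (Y \<omega>)) \<and> integral\<^sup>L (P \<theta>) (\<lambda>\<omega>. \<delta> (Y \<omega>)) = g \<theta>)"

definition umvue ::
  "'p set \<Rightarrow> ('p \<Rightarrow> 'a measure) \<Rightarrow> ('a \<Rightarrow> 's) \<Rightarrow> 's measure \<Rightarrow> ('p \<Rightarrow> real) \<Rightarrow> ('s \<Rightarrow> real) \<Rightarrow> bool" where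
  "umvue \<Theta> P Y S g \<delta> \<longleftrightarrow>
     unbiased_estimator \<Theta> P Y S g \<delta> \<and>
     (\<forall>\<delta>'. unbiased_estimator \<Theta> P Y S g \<delta>' \<longrightarrow>
        (\<forall>\<theta>\<in>\<Theta>. evariance (P \<theta>) (\<lambda>\<omega>. \<delta> (Y \<omega>)) \<le> evariance (P \<theta>) (\<lambda>\<omega>. \<delta>' (Y \<omega>))))"

end

theory Submission
  imports Defs
begin

text \<open>
  The law of the sample under \<open>\<theta> + k\<close> has density \<open>K * exp (- k * T)\<close> with respect to the law under
  \<open>\<theta>\<close>. Hence if \<open>D\<close> is the difference of two unbiased estimators of the same function, then
  \<open>E (D * Z ^ k) = 0\<close> for \<open>Z = exp (- T)\<close> and all natural \<open>k\<close>. As \<open>Z\<close> takes values in \<open>[0, 1]\<close>, the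
  Weierstrass approximation theorem gives \<open>E (D * h T) = 0\<close> for every bounded Borel function \<open>h\<close>, so a
  bounded function of \<open>T\<close> is orthogonal to every unbiased estimator of zero and thus has minimal
  variance; no conditional expectation is needed.

  Unbiasedness rests on the density of \<open>T\<close>. A Lindley density is a mixture of two Erlang densities of the
  same rate, so the \<open>n\<close>-fold convolution is a binomial mixture of Erlang densities, namely
  \<open>(\<theta>\<^sup>2 / (1 + \<theta>)) ^ n * exp (- \<theta> * t) * A_fun n t\<close>. The sum in the estimator of the density is
  \<open>A_fun (n - 1) (t - x)\<close>, and the estimator of the distribution function is the integral of the
  estimator of the density over \<open>(0, x]\<close>.
\<close>

section \<open>Completeness from moments on the unit interval\<close>

lemma integrable_mult_bounded:
  fixes D h :: "'a \<Rightarrow> real"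
  assumes D: "integrable M D" and h: "h \<in> borel_measurable M" and b: "AE x in M. \<bar>h x\<bar> \<le> B"
  shows "integrable M (\<lambda>x. D x * h x)"
proof (rule Bochner_Integration.integrable_bound[where f = "\<lambda>x. B * D x"])
  show "integrable M (\<lambda>x. B * D x)" using D by simp
  show "(\<lambda>x. D x * h x) \<in> borel_measurable M" using D h by measurable
  show "AE x in M. norm (D x * h x) \<le> norm (B * D x)"
    using b
  proof eventually_elim
    case (elim x)
    then have "\<bar>h x\<bar> * \<bar>D x\<bar> \<le> \<bar>B\<bar> * \<bar>D x\<bar>" by (intro mult_right_mono) auto
    then show ?case by (simp add: abs_mult mult.commute)
  qed
qed

text \<open>By the moment condition a polynomial \<open>g\<close> within \<open>e\<close> of
  \<open>\<phi>\<close> on the unit interval contributes nothing, so the integral is at most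
  \<open>e\<close> times that of the modulus of \<open>D\<close>; then \<open>e\<close> tends to
  0.\<close>

lemma integral_mult_continuous_eq_0:
  fixes D Z :: "'a \<Rightarrow> real" and \<phi> :: "real \<Rightarrow> real"
  assumes D: "integrable M D" and Z[measurable]: "Z \<in> borel_measurable M"
    and Z01: "AE x in M. Z x \<in> {0..1}"
    and moments: "\<And>k. (\<integral>x. D x * Z x ^ k \<partial>M) = 0"
    and \<phi>: "continuous_on UNIV \<phi>"
  shows "(\<integral>x. D x * \<phi> (Z x) \<partial>M) = 0"
proof -
  have [measurable]: "D \<in> borel_measurable M" using D by auto
  have [measurable]: "\<phi> \<in> borel_measurable borel" using \<phi> by (rule borel_measurable_continuous_onI)
  have Zk: "integrable M (\<lambda>x. D x * Z x ^ k)" for k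
    by (intro integrable_mult_bounded[OF D, where B = 1] eventually_mono[OF Z01])
      (auto simp: power_abs power_le_one)
  have "compact (\<phi> ` {0..1})"
    by (intro compact_continuous_image continuous_on_subset[OF \<phi>]) auto
  then obtain B where B: "\<And>z. z \<in> {0..1} \<Longrightarrow> \<bar>\<phi> z\<bar> \<le> B"
    by (force dest!: compact_imp_bounded simp: bounded_iff)
  have int: "integrable M (\<lambda>x. D x * \<phi> (Z x))"
    using B by (intro integrable_mult_bounded[OF D, where B = B] eventually_mono[OF Z01]) auto
  have "\<bar>\<integral>x. D x * \<phi> (Z x) \<partial>M\<bar> \<le> e * (\<integral>x. \<bar>D x\<bar> \<partial>M)" if e: "e > 0" for e
  proof -
    obtain g where g: "real_polynomial_function g" "\<And>z. z \<in> {0..1} \<Longrightarrow> \<bar>\<phi> z - g z\<bar> < e"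
      using Stone_Weierstrass_real_polynomial_function[OF compact_Icc continuous_on_subset[OF \<phi> subset_UNIV] e]
      by metis
    then obtain a N where g_eq: "g = (\<lambda>z. \<Sum>i\<le>N. a i * z ^ i)"
      by (auto simp: real_polynomial_function_iff_sum)
    have Dg: "(\<lambda>x. D x * g (Z x)) = (\<lambda>x. \<Sum>i\<le>N. a i * (D x * Z x ^ i))"
      by (simp add: g_eq sum_distrib_left mult_ac)
    have ig: "integrable M (\<lambda>x. D x * g (Z x))" and zg: "(\<integral>x. D x * g (Z x) \<partial>M) = 0"
      unfolding Dg using Zk by (simp_all add: moments)
    have "\<bar>\<integral>x. D x * \<phi> (Z x) \<partial>M\<bar> = \<bar>\<integral>x. D x * \<phi> (Z x) - D x * g (Z x) \<partial>M\<bar>"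
      by (simp add: int ig zg)
    also have "\<dots> \<le> (\<integral>x. \<bar>D x * \<phi> (Z x) - D x * g (Z x)\<bar> \<partial>M)"
      by (rule integral_abs_bound)
    also have "\<dots> \<le> (\<integral>x. e * \<bar>D x\<bar> \<partial>M)"
    proof (rule integral_mono_AE)
      show "AE x in M. \<bar>D x * \<phi> (Z x) - D x * g (Z x)\<bar> \<le> e * \<bar>D x\<bar>"
        using Z01
      proof eventually_elim
        case (elim x)
        then have "\<bar>\<phi> (Z x) - g (Z x)\<bar> \<le> e" using g(2)[of "Z x"] by auto
        then have "\<bar>D x\<bar> * \<bar>\<phi> (Z x) - g (Z x)\<bar> \<le> \<bar>D x\<bar> * e" by (intro mult_left_mono) auto
        then show ?case by (simp add: abs_mult[symmetric] right_diff_distrib mult.commute)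
      qed
    qed (use D int ig in auto)
    finally show ?thesis by simp
  qed
  \<comment> \<open>The bound is known for positive \<open>e\<close> only, hence the one-sided limit
    at 0.\<close>
  then have "((\<lambda>e. e * (\<integral>x. \<bar>D x\<bar> \<partial>M)) \<longlongrightarrow> 0 * (\<integral>x. \<bar>D x\<bar> \<partial>M)) (at_right 0) \<Longrightarrow>
      \<bar>\<integral>x. D x * \<phi> (Z x) \<partial>M\<bar> \<le> 0 * (\<integral>x. \<bar>D x\<bar> \<partial>M)"
    by (intro tendsto_lowerbound[where F = "at_right (0::real)"])
       (auto simp: eventually_at_right_less eventually_at_filter)
  moreover have "((\<lambda>e. e * (\<integral>x. \<bar>D x\<bar> \<partial>M)) \<longlongrightarrow> 0 * (\<integral>x. \<bar>D x\<bar> \<partial>M)) (at_right 0)"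
    by (intro tendsto_intros)
  ultimately show ?thesis by simp
qed

text \<open>Continuous ramps converge pointwise to the indicator, with the modulus of
  \<open>D\<close> as dominating function. The half-line is open because every ramp is 0 at
  \<open>a\<close>.\<close>

lemma integral_mult_indicator_eq_0:
  fixes D Z :: "'a \<Rightarrow> real"
  assumes D: "integrable M D" and Z[measurable]: "Z \<in> borel_measurable M"
    and Z01: "AE x in M. Z x \<in> {0..1}"
    and moments: "\<And>k. (\<integral>x. D x * Z x ^ k \<partial>M) = 0"
  shows "(\<integral>x. D x * indicator {a<..} (Z x) \<partial>M) = 0"
proof -
  have [measurable]: "D \<in> borel_measurable M" using D by auto
  \<comment> \<open>For \<open>k > 0\<close> the ramp climbs from 0 at \<open>a\<close> to 1 at
    \<open>a + 1 / k\<close>.\<close>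
  define \<phi> where "\<phi> k z = min 1 (max 0 (real k * (z - a)))" for k z
  have cont: "continuous_on UNIV (\<phi> k)" for k
    unfolding \<phi>_def by (intro continuous_intros)
  have [measurable]: "\<phi> k \<in> borel_measurable borel" for k
    using cont by (rule borel_measurable_continuous_onI)
  have lim: "(\<lambda>k. \<phi> k z) \<longlonglongrightarrow> indicator {a<..} z" for z
  proof (cases "z > a")
    case True
    obtain N where N: "real N * (z - a) > 1"
      using reals_Archimedean3[of "z - a"] True by auto
    have "eventually (\<lambda>k. \<phi> k z = 1) sequentially"
      using eventually_ge_at_top[of N]
    proof eventually_elim
      case (elim k)
      then have "real N * (z - a) \<le> real k * (z - a)" using True by (intro mult_right_mono) auto
      then show ?case using N by (simp add: \<phi>_def)
    qed
    then show ?thesis using True by (simp add: tendsto_eventually)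
  next
    case False
    then have "\<phi> k z = 0" for k by (simp add: \<phi>_def mult_nonneg_nonpos)
    then show ?thesis using False by simp
  qed
  have "(\<lambda>k. \<integral>x. D x * \<phi> k (Z x) \<partial>M) \<longlonglongrightarrow> (\<integral>x. D x * indicator {a<..} (Z x) \<partial>M)"
  proof (rule integral_dominated_convergence[where w = "\<lambda>x. \<bar>D x\<bar>"])
    show "AE x in M. norm (D x * \<phi> k (Z x)) \<le> \<bar>D x\<bar>" for k
      by (rule AE_I2) (simp add: abs_mult \<phi>_def mult_left_le)
  qed (use D lim in \<open>auto intro!: tendsto_mult\<close>)
  then show ?thesis
    using integral_mult_continuous_eq_0[OF D Z Z01 moments cont] LIMSEQ_unique[OF _ tendsto_const] by simp
qed

text \<open>Weighting \<open>M\<close> by the positive and by the negative part of \<open>D\<close>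
  gives two finite measures. Their images under \<open>Z\<close> agree on open half-lines, hence
  coincide and integrate \<open>\<psi>\<close> alike.\<close>

lemma integral_mult_bounded_eq_0:
  fixes D Z :: "'a \<Rightarrow> real" and \<psi> :: "real \<Rightarrow> real"
  assumes D: "integrable M D" and Z[measurable]: "Z \<in> borel_measurable M"
    and Z01: "AE x in M. Z x \<in> {0..1}"
    and moments: "\<And>k. (\<integral>x. D x * Z x ^ k \<partial>M) = 0"
    and \<psi>[measurable]: "\<psi> \<in> borel_measurable borel" and bound: "\<And>z. \<bar>\<psi> z\<bar> \<le> B"
  shows "(\<integral>x. D x * \<psi> (Z x) \<partial>M) = 0"
proof -
  have [measurable]: "D \<in> borel_measurable M" using D by auto
  define p where "p x = max 0 (D x)" for x
  define m where "m x = max 0 (- D x)" for x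
  have pm: "D x = p x - m x" "p x \<ge> 0" "m x \<ge> 0" for x by (auto simp: p_def m_def)
  have p: "integrable M p" and m: "integrable M m"
    unfolding p_def m_def using D by auto
  have [measurable]: "p \<in> borel_measurable M" "m \<in> borel_measurable M" using p m by auto
  have law: "(\<integral>x. r x * h (Z x) \<partial>M) = (\<integral>z. h z \<partial>distr (density M r) borel Z)"
    if [measurable]: "r \<in> borel_measurable M" "h \<in> borel_measurable borel" and "\<And>x. r x \<ge> 0"
    for r h :: "_ \<Rightarrow> real"
    by (subst integral_distr) (use that in \<open>simp_all add: integral_density\<close>)
  have tail: "emeasure (distr (density M r) borel Z) {a<..} = ennreal (\<integral>x. r x * indicator {a<..} (Z x) \<partial>M)"
    if r: "integrable M r" and r0: "\<And>x. r x \<ge> 0" for r a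
  proof -
    have [measurable]: "r \<in> borel_measurable M" using r by auto
    have i: "integrable M (\<lambda>x. r x * indicator {a<..} (Z x))"
      by (rule integrable_mult_bounded[OF r, where B = 1]) (auto split: split_indicator)
    have "emeasure (distr (density M r) borel Z) {a<..} = (\<integral>\<^sup>+x. indicator {a<..} x \<partial>distr (density M r) borel Z)"
      by simp
    also have "\<dots> = (\<integral>\<^sup>+x. ennreal (r x) * indicator {a<..} (Z x) \<partial>M)"
      by (subst nn_integral_distr) (simp_all add: nn_integral_density)
    also have "\<dots> = (\<integral>\<^sup>+x. ennreal (r x * indicator {a<..} (Z x)) \<partial>M)"
      by (intro nn_integral_cong) (auto split: split_indicator)
    also have "\<dots> = ennreal (\<integral>x. r x * indicator {a<..} (Z x) \<partial>M)"
      using i r0 by (intro nn_integral_eq_integral) auto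
    finally show ?thesis .
  qed
  have "distr (density M p) borel Z = distr (density M m) borel Z"
  proof (rule measure_eqI_lessThan)
    fix a
    have "0 = (\<integral>x. p x * indicator {a<..} (Z x) - m x * indicator {a<..} (Z x) \<partial>M)"
      using integral_mult_indicator_eq_0[OF D Z Z01 moments, of a] by (simp add: pm(1) left_diff_distrib)
    also have "\<dots> = (\<integral>x. p x * indicator {a<..} (Z x) \<partial>M) - (\<integral>x. m x * indicator {a<..} (Z x) \<partial>M)"
      by (intro Bochner_Integration.integral_diff integrable_mult_bounded[OF p, where B = 1]
          integrable_mult_bounded[OF m, where B = 1]) (auto split: split_indicator)
    finally show "emeasure (distr (density M p) borel Z) {a<..} = emeasure (distr (density M m) borel Z) {a<..}"
      by (simp add: tail p m pm)
  qed (simp_all add: tail p pm)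
  then have "(\<integral>x. p x * \<psi> (Z x) \<partial>M) = (\<integral>x. m x * \<psi> (Z x) \<partial>M)"
    by (simp add: law pm)
  moreover have "integrable M (\<lambda>x. p x * \<psi> (Z x))" "integrable M (\<lambda>x. m x * \<psi> (Z x))"
    using bound by (auto intro!: integrable_mult_bounded p m)
  ultimately show ?thesis by (simp add: pm(1) left_diff_distrib)
qed

text \<open>With \<open>D = d' - d\<close>, the square \<open>(d' - g)\<^sup>2\<close> exceeds
  \<open>(d - g)\<^sup>2\<close> by \<open>D\<^sup>2\<close> plus multiples of \<open>D * d\<close>
  and \<open>D\<close>, both of integral 0. An infinite variance of \<open>d'\<close> leaves nothing
  to prove.\<close>

lemma evariance_le:
  assumes "prob_space M" and d: "integrable M d" "integrable M d'" "integral\<^sup>L M d = integral\<^sup>L M d'"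
    and bound: "\<And>x. \<bar>d x\<bar> \<le> B"
    and orth: "(\<integral>x. (d' x - d x) * d x \<partial>M) = 0"
  shows "evariance M d \<le> evariance M d'"
proof (cases "evariance M d' = \<infinity>")
  case False
  interpret prob_space M by fact
  define g where "g = integral\<^sup>L M d"
  have [measurable]: "d \<in> borel_measurable M" "d' \<in> borel_measurable M" using d by auto
  have d'2: "integrable M (\<lambda>x. (d' x - g)\<^sup>2)"
    using False d(3) by (intro integrableI_nonneg) (auto simp: evariance_def g_def top.not_eq_extremum)
  have d2: "integrable M (\<lambda>x. (d x - g)\<^sup>2)"
  proof (rule integrable_const_bound[where B = "(B + \<bar>g\<bar>)\<^sup>2"])
    show "AE x in M. norm ((d x - g)\<^sup>2) \<le> (B + \<bar>g\<bar>)\<^sup>2"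
    proof (rule AE_I2)
      fix x
      have "\<bar>d x - g\<bar> \<le> \<bar>B + \<bar>g\<bar>\<bar>" using bound[of x] by linarith
      then show "norm ((d x - g)\<^sup>2) \<le> (B + \<bar>g\<bar>)\<^sup>2" by (simp add: abs_le_square_iff)
    qed
  qed simp
  have D: "integrable M (\<lambda>x. d' x - d x)" using d by simp
  have Dd: "integrable M (\<lambda>x. (d' x - d x) * d x)"
    using bound by (intro integrable_mult_bounded[OF D]) auto
  have i: "integrable M (\<lambda>x. 2 * ((d' x - d x) * d x) - 2 * g * (d' x - d x))"
    using Dd d by simp
  \<comment> \<open>The added bracket has integral 0: its first part by \<open>orth\<close>, its
    second by equality of the means.\<close>
  have "(\<integral>x. (d x - g)\<^sup>2 \<partial>M) =
      (\<integral>x. (d x - g)\<^sup>2 + (2 * ((d' x - d x) * d x) - 2 * g * (d' x - d x)) \<partial>M)"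
    using d2 Dd D d orth by simp
  also have "\<dots> \<le> (\<integral>x. (d' x - g)\<^sup>2 \<partial>M)"
  proof (intro integral_mono d'2 Bochner_Integration.integrable_add d2 i)
    fix x
    have "0 \<le> (d' x - d x)\<^sup>2" by simp
    also have "\<dots> = (d' x - g)\<^sup>2 - ((d x - g)\<^sup>2 + (2 * ((d' x - d x) * d x) - 2 * g * (d' x - d x)))"
      by (simp add: power2_eq_square algebra_simps)
    finally show "(d x - g)\<^sup>2 + (2 * ((d' x - d x) * d x) - 2 * g * (d' x - d x)) \<le> (d' x - g)\<^sup>2" by simp
  qed
  finally show ?thesis
    using d2 d'2 d(3) by (simp add: evariance_def g_def nn_integral_eq_integral)
qed simp

section \<open>The distribution of the sum\<close>

text \<open>Pascal's rule, with an arbitrary sequence \<open>F\<close> carried along. It updates the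
  mixture weights when one more observation is added to the sum.\<close>

lemma binomial_step_sum:
  fixes b c :: "'a::comm_ring_1"
  shows "(\<Sum>j\<le>n. of_nat (n choose j) * b ^ j * c ^ (n - j) * (b * F (Suc j) + c * F j)) =
         (\<Sum>j\<le>Suc n. of_nat (Suc n choose j) * b ^ j * c ^ (Suc n - j) * F j)"
proof -
  \<comment> \<open>The new top term is 0 since \<open>n choose Suc n = 0\<close>; with it the index
    shift ends at \<open>n\<close>.\<close>
  have "(\<Sum>j\<le>n. of_nat (n choose j) * b ^ j * c ^ (n - j) * (c * F j)) =
      (\<Sum>j\<le>Suc n. of_nat (n choose j) * b ^ j * c ^ (Suc n - j) * F j)"
    by (simp add: Suc_diff_le mult_ac binomial_eq_0)
  also have "\<dots> = c ^ Suc n * F 0 + (\<Sum>j\<le>n. of_nat (n choose Suc j) * b ^ Suc j * c ^ (n - j) * F (Suc j))"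
    by (subst sum.atMost_Suc_shift) (simp add: binomial_eq_0)
  finally have 1: "(\<Sum>j\<le>n. of_nat (n choose j) * b ^ j * c ^ (n - j) * (c * F j)) = \<dots>" .
  show ?thesis
    using 1 by (subst sum.atMost_Suc_shift)
       (simp add: distrib_left sum.distrib distrib_right mult_ac add_ac)
qed

section \<open>The polynomial \<open>A_fun\<close> and the density of the sum\<close>

lemma Gamma_of_nat_diff: "j < m \<Longrightarrow> Gamma (real m - real j) = fact (m - j - 1)"
  using Gamma_fact[of "m - j - 1", where ?'a = real] by (simp add: of_nat_diff)

lemma A_fun_fact: "n \<ge> 1 \<Longrightarrow> A_fun n t = (\<Sum>j\<le>n. real (n choose j) * (t ^ (2 * n - j - 1) / fact (2 * n - j - 1)))"
  unfolding A_fun_def atLeast0AtMost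
  using Gamma_of_nat_diff[of _ "2 * n"] by (intro sum.cong) auto

lemma A_fun_pos: "n \<ge> 1 \<Longrightarrow> t > 0 \<Longrightarrow> A_fun n t > 0"
  unfolding A_fun_fact by (intro sum_pos) auto

lemma A_fun_nonneg: "n \<ge> 1 \<Longrightarrow> t \<ge> 0 \<Longrightarrow> A_fun n t \<ge> 0"
  unfolding A_fun_fact by (intro sum_nonneg) auto

lemma borel_measurable_A_fun [measurable]: "A_fun n \<in> borel_measurable borel"
  unfolding A_fun_def by measurable

text \<open>The density of a sum of \<open>n\<close> observations, as \<open>distributed_sum\<close>
  will show. The cut at \<open>t < 0\<close> is that of \<open>erlang_density\<close>, so the
  mixture identity holds at every point.\<close>

definition lindley_sum_pdf :: "nat \<Rightarrow> real \<Rightarrow> real \<Rightarrow> real" where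
  "lindley_sum_pdf n \<theta> t = (if t < 0 then 0 else (\<theta>\<^sup>2 / (1 + \<theta>)) ^ n * exp (- \<theta> * t) * A_fun n t)"

lemma borel_measurable_lindley_sum_pdf [measurable]: "lindley_sum_pdf n \<theta> \<in> borel_measurable borel"
  unfolding lindley_sum_pdf_def by measurable

lemma borel_measurable_lindley_pdf [measurable]: "lindley_pdf \<theta> \<in> borel_measurable borel"
  unfolding lindley_pdf_def by measurable

lemma lindley_pdf_nonneg: "\<theta> > 0 \<Longrightarrow> lindley_pdf \<theta> y \<ge> 0"
  by (simp add: lindley_pdf_def)

lemma lindley_sum_pdf_nonneg: "\<theta> > 0 \<Longrightarrow> n \<ge> 1 \<Longrightarrow> lindley_sum_pdf n \<theta> t \<ge> 0"
  by (simp add: lindley_sum_pdf_def A_fun_nonneg)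

text \<open>A Lindley density mixes the Erlang densities of shape 1 and 2 with weights
  \<open>\<theta> / (1 + \<theta>)\<close> and \<open>1 / (1 + \<theta>)\<close>. If
  \<open>j\<close> of the \<open>n\<close> summands have shape 1, the total shape is
  \<open>2 * n - j\<close>; \<open>erlang_density\<close> is indexed by the shape minus one.\<close>

lemma lindley_sum_pdf_erlang:
  assumes "n \<ge> 1" "\<theta> > 0"
  shows "lindley_sum_pdf n \<theta> t =
    (\<Sum>j\<le>n. real (n choose j) * (\<theta> / (1 + \<theta>)) ^ j * (1 / (1 + \<theta>)) ^ (n - j) * erlang_density (2 * n - j - 1) \<theta> t)"
proof (cases "t < 0")
  case False
  \<comment> \<open>The mixture weight carries \<open>j\<close> powers of \<open>\<theta>\<close>,
    the Erlang density the other \<open>2 * n - j\<close>.\<close>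
  have "(\<theta>\<^sup>2 / (1 + \<theta>)) ^ n = \<theta> ^ j * \<theta> ^ Suc (2 * n - j - 1) / ((1 + \<theta>) ^ j * (1 + \<theta>) ^ (n - j))"
    if "j \<le> n" for j
    using assms that by (simp add: power_divide power_mult[symmetric] power_add[symmetric] Suc_diff_Suc flip: power_Suc)
  then show ?thesis
    using False assms unfolding lindley_sum_pdf_def A_fun_fact[OF assms(1)] erlang_density_def
    by (auto simp: sum_distrib_left power_divide field_simps intro!: sum.cong)
qed (simp add: lindley_sum_pdf_def erlang_density_def)

text \<open>At \<open>0\<close> the two sides differ: \<^const>\<open>lindley_pdf\<close> vanishes there.\<close>

lemma lindley_pdf_eq_sum_pdf: "y \<noteq> 0 \<Longrightarrow> lindley_pdf \<theta> y = lindley_sum_pdf 1 \<theta> y"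
  by (simp add: lindley_pdf_def lindley_sum_pdf_def A_fun_fact algebra_simps)

text \<open>Both factors are mixtures of Erlang densities of the same rate, and convolving those of
  index \<open>k\<close> and \<open>l\<close> gives index \<open>Suc (k + l)\<close>. The new
  weights come from \<open>binomial_step_sum\<close>.\<close>

lemma lindley_convolution:
  assumes n: "n \<ge> 1" and \<theta>: "\<theta> > 0"
  shows "(\<integral>\<^sup>+y. ennreal (lindley_sum_pdf n \<theta> (t - y)) * ennreal (lindley_pdf \<theta> y) \<partial>lborel) =
    ennreal (lindley_sum_pdf (Suc n) \<theta> t)"
proof -
  define b where "b = \<theta> / (1 + \<theta>)"
  define c where "c = 1 / (1 + \<theta>)"
  define a where "a j = real (n choose j) * b ^ j * c ^ (n - j)" for j
  define e where "e k = erlang_density k \<theta>" for k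
  have nn: "a j \<ge> 0" "b \<ge> 0" "c \<ge> 0" "e k y \<ge> 0" for j k y
    using \<theta> by (simp_all add: a_def b_def c_def e_def)
  have [measurable]: "e k \<in> borel_measurable borel" for k by (simp add: e_def)
  have conv: "(\<integral>\<^sup>+y. ennreal (e k (t - y)) * ennreal (e l y) \<partial>lborel) = ennreal (e (Suc (k + l)) t)" for k l
    using fun_cong[OF convolution_erlang_density[OF \<theta>, of k l], of t] by (simp add: e_def)
  have f: "lindley_sum_pdf 1 \<theta> y = b * e 0 y + c * e 1 y" for y
    using \<theta> by (simp add: lindley_sum_pdf_erlang b_def c_def e_def)
  have "(\<integral>\<^sup>+y. ennreal (lindley_sum_pdf n \<theta> (t - y)) * ennreal (lindley_pdf \<theta> y) \<partial>lborel) =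
      (\<integral>\<^sup>+y. ennreal (lindley_sum_pdf n \<theta> (t - y)) * ennreal (lindley_sum_pdf 1 \<theta> y) \<partial>lborel)"
    using AE_lborel_singleton[of 0] by (intro nn_integral_cong_AE) (auto simp: lindley_pdf_eq_sum_pdf elim!: eventually_mono)
  also have "\<dots> = (\<integral>\<^sup>+y. (\<Sum>j\<le>n. ennreal (a j * b) * (ennreal (e (2 * n - j - 1) (t - y)) * ennreal (e 0 y)) +
      ennreal (a j * c) * (ennreal (e (2 * n - j - 1) (t - y)) * ennreal (e 1 y))) \<partial>lborel)"
  proof (intro nn_integral_cong)
    fix y
    have "lindley_sum_pdf n \<theta> (t - y) * lindley_sum_pdf 1 \<theta> y =
        (\<Sum>j\<le>n. a j * e (2 * n - j - 1) (t - y)) * (b * e 0 y + c * e 1 y)"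
      using n \<theta> by (simp only: f) (simp add: lindley_sum_pdf_erlang a_def b_def c_def e_def)
    also have "\<dots> = (\<Sum>j\<le>n. a j * b * (e (2 * n - j - 1) (t - y) * e 0 y) + a j * c * (e (2 * n - j - 1) (t - y) * e 1 y))"
      by (simp add: sum_distrib_right sum_distrib_left sum.distrib algebra_simps)
    finally show "ennreal (lindley_sum_pdf n \<theta> (t - y)) * ennreal (lindley_sum_pdf 1 \<theta> y) =
        (\<Sum>j\<le>n. ennreal (a j * b) * (ennreal (e (2 * n - j - 1) (t - y)) * ennreal (e 0 y)) +
        ennreal (a j * c) * (ennreal (e (2 * n - j - 1) (t - y)) * ennreal (e 1 y)))"
      using n \<theta> nn by (simp add: lindley_sum_pdf_nonneg flip: ennreal_mult ennreal_plus sum_ennreal)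
  qed
  also have "\<dots> = (\<Sum>j\<le>n. ennreal (a j * b) * ennreal (e (2 * n - j) t) + ennreal (a j * c) * ennreal (e (Suc (2 * n - j)) t))"
  proof -
    have "Suc (2 * n - Suc j) = 2 * n - j" if "j \<le> n" for j using n that by simp
    then show ?thesis
      by (simp add: nn_integral_sum nn_integral_add nn_integral_cmult conv cong: sum.cong_simp)
  qed
  also have "\<dots> = ennreal (\<Sum>j\<le>n. a j * (b * e (2 * n - j) t + c * e (Suc (2 * n - j)) t))"
    using nn by (simp add: distrib_left mult.assoc flip: ennreal_mult ennreal_plus sum_ennreal)
  \<comment> \<open>Both indices take the form \<open>2 * Suc n - i - 1\<close>, with
    \<open>i = Suc j\<close> and \<open>i = j\<close>, to match \<open>F (Suc j)\<close> and
    \<open>F j\<close> in \<open>binomial_step_sum\<close>.\<close>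
  also have "(\<Sum>j\<le>n. a j * (b * e (2 * n - j) t + c * e (Suc (2 * n - j)) t)) =
      (\<Sum>j\<le>n. real (n choose j) * b ^ j * c ^ (n - j) *
        (b * e (2 * Suc n - Suc j - 1) t + c * e (2 * Suc n - j - 1) t))"
    unfolding a_def by (intro sum.cong) (auto simp: Suc_diff_le)
  also have "\<dots> = lindley_sum_pdf (Suc n) \<theta> t"
    unfolding binomial_step_sum[where F = "\<lambda>j. e (2 * Suc n - j - 1) t"]
    using \<theta> by (simp add: lindley_sum_pdf_erlang b_def c_def e_def del: power_Suc sum.atMost_Suc)
  finally show ?thesis .
qed

section \<open>The two estimators\<close>

text \<open>Since \<open>2 * n - 2 - k = 2 * (n - 1) - k\<close>, the coefficients are those of
  \<open>A_fun (n - 1)\<close>. The result is the conditional density of one observation given the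
  sum, with all factors in \<open>\<theta>\<close> cancelled.\<close>

lemma pdf_estimate_A_fun:
  assumes "n \<ge> 2"
  shows "pdf_estimate n x t = (if x < t then (1 + x) * A_fun (n - 1) (t - x) / A_fun n t else 0)"
proof -
  have "C_coeff k n * s ^ (2 * n - 3 - k) =
      real (n - 1 choose k) * (s ^ (2 * (n - 1) - k - 1) / Gamma (2 * real (n - 1) - real k))" for k s
    using assms by (simp add: C_coeff_def of_nat_diff diff_commute numeral_3_eq_3 numeral_2_eq_2)
  then show ?thesis by (simp add: pdf_estimate_def A_fun_def)
qed

text \<open>Joint measurability in the point and the statistic, for the later exchange of
  integrals.\<close>

lemma borel_measurable_pdf_estimate [measurable]:
  assumes [measurable]: "f \<in> borel_measurable M" "g \<in> borel_measurable M"
  shows "(\<lambda>w. pdf_estimate n (f w) (g w)) \<in> borel_measurable M"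
  unfolding pdf_estimate_def by measurable

lemma pdf_estimate_nonneg:
  assumes "n \<ge> 2" "x \<ge> 0"
  shows "pdf_estimate n x t \<ge> 0"
  using assms by (auto simp: pdf_estimate_A_fun intro!: divide_nonneg_nonneg mult_nonneg_nonneg A_fun_nonneg)

text \<open>Each term of \<open>A_fun (n - 1) (t - x)\<close> has two powers fewer than the matching
  term of \<open>A_fun n t\<close>, and \<open>t > x > 0\<close> keeps the quotient bounded. The
  optimality argument applies to bounded functions of the sum.\<close>

lemma pdf_estimate_bounded:
  assumes n: "n \<ge> 2" and x: "x > 0"
  shows "\<exists>B. \<forall>t. \<bar>pdf_estimate n x t\<bar> \<le> B"
proof -
  \<comment> \<open>The ratio of the coefficients of index \<open>j\<close>; the factor
    \<open>1 / x\<^sup>2\<close> bounds \<open>1 / t\<^sup>2\<close>, which makes up for the two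
    missing powers.\<close>
  define K where "K j = real (n - 1 choose j) / fact (2 * (n - 1) - j - 1) * (fact (2 * n - j - 1) / real (n choose j)) / x\<^sup>2" for j
  have K: "K j \<ge> 0" for j by (simp add: K_def)
  have bound: "A_fun (n - 1) (t - x) \<le> (\<Sum>j\<le>n-1. K j) * A_fun n t" if "x < t" for t
  proof -
    have "real (n - 1 choose j) * ((t - x) ^ (2 * (n - 1) - j - 1) / fact (2 * (n - 1) - j - 1)) \<le> K j * A_fun n t"
      if j: "j \<le> n - 1" for j
    proof -
      have t: "t > 0" and c: "real (n choose j) > 0" using x \<open>x < t\<close> j by auto
      have "(t - x) ^ (2 * (n - 1) - j - 1) \<le> t ^ (2 * (n - 1) - j - 1)"
        using x \<open>x < t\<close> by (intro power_mono) auto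
      also have "\<dots> = t ^ (2 * n - j - 1) / t\<^sup>2"
      proof -
        have "2 * n - j - 1 = (2 * (n - 1) - j - 1) + 2" using n j by simp
        then show ?thesis using t by (simp add: power_add power2_eq_square)
      qed
      also have "\<dots> \<le> t ^ (2 * n - j - 1) / x\<^sup>2"
        using x \<open>x < t\<close> by (intro divide_left_mono power_mono) auto
      also have "\<dots> \<le> (fact (2 * n - j - 1) / real (n choose j) * A_fun n t) / x\<^sup>2"
      proof (rule divide_right_mono)
        have "real (n choose j) * (t ^ (2 * n - j - 1) / fact (2 * n - j - 1)) \<le> A_fun n t"
          using n t j unfolding A_fun_fact[OF order.trans[OF one_le_numeral n]]
          by (intro member_le_sum) auto
        then show "t ^ (2 * n - j - 1) \<le> fact (2 * n - j - 1) / real (n choose j) * A_fun n t"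
          using c by (simp add: field_simps)
      qed simp
      finally have "real (n - 1 choose j) / fact (2 * (n - 1) - j - 1) * (t - x) ^ (2 * (n - 1) - j - 1) \<le>
          real (n - 1 choose j) / fact (2 * (n - 1) - j - 1) * ((fact (2 * n - j - 1) / real (n choose j) * A_fun n t) / x\<^sup>2)"
        by (intro mult_left_mono) auto
      then show ?thesis by (simp add: K_def)
    qed
    moreover have "1 \<le> n - 1" using n by simp
    ultimately show ?thesis
      by (simp only: A_fun_fact sum_distrib_right) (intro sum_mono, simp)
  qed
  have "\<bar>pdf_estimate n x t\<bar> \<le> (1 + x) * (\<Sum>j\<le>n-1. K j)" for t
  proof (cases "x < t")
    case True
    then have A: "A_fun n t > 0" using n x by (intro A_fun_pos) auto
    have "(1 + x) * A_fun (n - 1) (t - x) / A_fun n t \<le> (1 + x) * (\<Sum>j\<le>n-1. K j)"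
      using bound[OF True] A x by (simp add: divide_le_eq mult.assoc)
    then show ?thesis
      using True n x pdf_estimate_nonneg[of n x t] by (simp add: pdf_estimate_A_fun)
  next
    case False
    then show ?thesis using x K by (simp add: pdf_estimate_def sum_nonneg)
  qed
  then show ?thesis by blast
qed

text \<open>Two factorizations of the joint density of one observation and the sum. At
  \<open>t = x\<close> they can differ: the estimator is 0 there, while
  \<open>lindley_sum_pdf 1 \<theta> 0\<close> is positive, which matters for
  \<open>n = 2\<close>.\<close>

lemma lindley_sum_pdf_mult_pdf_estimate:
  assumes n: "n \<ge> 2" and x: "x > 0" and \<theta>: "\<theta> > 0" and "t \<noteq> x"
  shows "lindley_sum_pdf n \<theta> t * pdf_estimate n x t = lindley_sum_pdf (n - 1) \<theta> (t - x) * lindley_pdf \<theta> x"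
proof (cases "x < t")
  case True
  then have A: "A_fun n t > 0" using n x by (intro A_fun_pos) auto
  have "(\<theta>\<^sup>2 / (1 + \<theta>)) ^ n = (\<theta>\<^sup>2 / (1 + \<theta>)) ^ (n - 1) * (\<theta>\<^sup>2 / (1 + \<theta>))"
    using n by (simp add: power_eq_if)
  moreover have "exp (- \<theta> * t) = exp (- \<theta> * (t - x)) * exp (- \<theta> * x)"
    by (simp add: algebra_simps flip: exp_add)
  ultimately show ?thesis
    using True A x n by (simp only: lindley_sum_pdf_def pdf_estimate_A_fun lindley_pdf_def) simp
qed (use assms in \<open>auto simp: pdf_estimate_def lindley_sum_pdf_def\<close>)

text \<open>For fixed \<open>x\<close> the factorization integrates over \<open>t\<close> to
  \<open>lindley_pdf \<theta> x\<close> times the mass of a translated density. This is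
  unbiasedness; \<open>total\<close> is later read off from the sample.\<close>

lemma nn_integral_lindley_sum_pdf_pdf_estimate:
  assumes n: "n \<ge> 2" and x: "x > 0" and \<theta>: "\<theta> > 0"
    and total: "(\<integral>\<^sup>+t. ennreal (lindley_sum_pdf (n - 1) \<theta> t) \<partial>lborel) = 1"
  shows "(\<integral>\<^sup>+t. ennreal (lindley_sum_pdf n \<theta> t) * ennreal (pdf_estimate n x t) \<partial>lborel) = ennreal (lindley_pdf \<theta> x)"
proof -
  have "(\<integral>\<^sup>+t. ennreal (lindley_sum_pdf n \<theta> t) * ennreal (pdf_estimate n x t) \<partial>lborel) =
      (\<integral>\<^sup>+t. ennreal (lindley_sum_pdf (n - 1) \<theta> (t - x)) * ennreal (lindley_pdf \<theta> x) \<partial>lborel)"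
  proof (intro nn_integral_cong_AE eventually_mono[OF AE_lborel_singleton[of x]])
    fix t :: real assume elim: "t \<noteq> x"
    then show "ennreal (lindley_sum_pdf n \<theta> t) * ennreal (pdf_estimate n x t) =
        ennreal (lindley_sum_pdf (n - 1) \<theta> (t - x)) * ennreal (lindley_pdf \<theta> x)"
      using lindley_sum_pdf_mult_pdf_estimate[OF n x \<theta> elim] n x \<theta>
      by (simp add: lindley_sum_pdf_nonneg pdf_estimate_nonneg lindley_pdf_nonneg flip: ennreal_mult)
  qed
  also have "\<dots> = (\<integral>\<^sup>+t. ennreal (lindley_sum_pdf (n - 1) \<theta> (t - x)) \<partial>lborel) * ennreal (lindley_pdf \<theta> x)"
    by (simp add: nn_integral_multc)
  also have "(\<integral>\<^sup>+t. ennreal (lindley_sum_pdf (n - 1) \<theta> (t - x)) \<partial>lborel) = 1"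
    using total nn_integral_real_affine[of "\<lambda>t. ennreal (lindley_sum_pdf (n - 1) \<theta> t)" 1 "- x"]
    by (simp add: add.commute)
  finally show ?thesis by simp
qed

text \<open>Here the same factorization is integrated over the point with \<open>t\<close> fixed:
  the right side becomes a convolution and returns the density of the sum at \<open>t\<close>, which
  cancels.\<close>

lemma nn_integral_pdf_estimate:
  assumes n: "n \<ge> 2" and t: "t > 0"
  shows "(\<integral>\<^sup>+y. ennreal (pdf_estimate n y t) * indicator {0<..} y \<partial>lborel) = 1"
proof -
  \<comment> \<open>The estimator is free of the parameter, so any positive value would do; 1 is
    chosen.\<close>
  let ?q = "lindley_sum_pdf n 1 t"
  have q: "?q > 0" using n t by (simp add: lindley_sum_pdf_def A_fun_pos)
  have "ennreal ?q * (\<integral>\<^sup>+y. ennreal (pdf_estimate n y t) * indicator {0<..} y \<partial>lborel) =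
      (\<integral>\<^sup>+y. ennreal ?q * (ennreal (pdf_estimate n y t) * indicator {0<..} y) \<partial>lborel)"
    by (subst nn_integral_cmult) auto
  also have "\<dots> = (\<integral>\<^sup>+y. ennreal (lindley_sum_pdf (n - 1) 1 (t - y)) * ennreal (lindley_pdf 1 y) \<partial>lborel)"
  proof (intro nn_integral_cong_AE eventually_mono[OF AE_lborel_singleton[of t]])
    fix y :: real assume "y \<noteq> t"
    then show "ennreal ?q * (ennreal (pdf_estimate n y t) * indicator {0<..} y) =
        ennreal (lindley_sum_pdf (n - 1) 1 (t - y)) * ennreal (lindley_pdf 1 y)"
      using lindley_sum_pdf_mult_pdf_estimate[of n y 1 t] n q
      by (cases "y > 0")
        (auto simp: lindley_sum_pdf_nonneg pdf_estimate_nonneg lindley_pdf_nonneg lindley_pdf_def[of 1 y] simp flip: ennreal_mult)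
  qed
  also have "\<dots> = ennreal ?q"
    using lindley_convolution[of "n - 1" 1 t] n by simp
  finally have "ennreal ?q * (\<integral>\<^sup>+y. ennreal (pdf_estimate n y t) * indicator {0<..} y \<partial>lborel) = ennreal ?q * 1"
    by simp
  then show ?thesis
    using q by (subst (asm) ennreal_mult_cancel_left) auto
qed

section \<open>Incomplete beta integrals and the estimator of the distribution function\<close>

lemma Beta_nat_1:
  assumes "m \<ge> 1" shows "Beta 1 (real m) = 1 / real m"
proof -
  obtain l where l: "m = Suc l" using assms by (cases m) auto
  have "Gamma (1 + real m) = fact m" "Gamma (real m) = fact l"
    using Gamma_fact[of m, where ?'a = real] Gamma_fact[of l, where ?'a = real] by (simp_all add: l)
  then show ?thesis by (simp add: Beta_def l)
qed

lemma Beta_nat_2: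
  assumes "m \<ge> 1" shows "Beta 2 (real m) = 1 / (real m * (real m + 1))"
proof -
  obtain l where l: "m = Suc l" using assms by (cases m) auto
  have "2 + real m = 1 + real (Suc m)" by simp
  then have "Gamma (2 + real m) = fact (Suc m)" "Gamma (real m) = fact l" "Gamma (2::real) = 1"
    using Gamma_fact[of "Suc m", where ?'a = real] Gamma_fact[of l, where ?'a = real]
      Gamma_fact[of 1, where ?'a = real] by (simp_all add: l)
  then show ?thesis by (simp add: Beta_def l add_ac)
qed

text \<open>Substitute \<open>y = t * u\<close>: the two powers give \<open>t ^ (a + m - 1)\<close>
  and the Jacobian one more factor \<open>t\<close>.\<close>

lemma set_integral_power_mult_reg_inc_beta:
  assumes x: "0 < x" "x < t" and m: "m \<ge> 1"
  shows "(LBINT y:{0..x}. y ^ a * (t - y) ^ (m - 1)) =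
    t ^ (a + m) * Beta (real a + 1) (real m) * reg_inc_beta (x / t) (real a + 1) (real m)"
proof -
  have t: "t > 0" using x by simp
  have "(LBINT y:{0..x}. y ^ a * (t - y) ^ (m - 1)) =
      t * (\<integral>u. indicator {0..x} (t * u) *\<^sub>R ((t * u) ^ a * (t - t * u) ^ (m - 1)) \<partial>lborel)"
    unfolding set_lebesgue_integral_def using t by (subst lborel_integral_real_affine[of t _ 0]) auto
  also have "(\<integral>u. indicator {0..x} (t * u) *\<^sub>R ((t * u) ^ a * (t - t * u) ^ (m - 1)) \<partial>lborel) =
      (\<integral>u. t ^ (a + m - 1) * (indicator {0..x/t} u *\<^sub>R (u powr (real a + 1 - 1) * (1 - u) powr (real m - 1))) \<partial>lborel)"
  proof (rule integral_cong_AE)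
    show "AE u in lborel. indicator {0..x} (t * u) *\<^sub>R ((t * u) ^ a * (t - t * u) ^ (m - 1)) =
        t ^ (a + m - 1) * (indicator {0..x/t} u *\<^sub>R (u powr (real a + 1 - 1) * (1 - u) powr (real m - 1)))"
      \<comment> \<open>The point 0 is left out because \<open>0 powr 0 = 0\<close> whereas
        \<open>0 ^ 0 = 1\<close>.\<close>
      using AE_lborel_singleton[of "0::real"]
    proof eventually_elim
      case (elim u)
      show ?case
      proof (cases "u \<in> {0..x/t}")
        case True
        have "u \<le> x / t" using True by simp
        also have "\<dots> < 1" using x by simp
        finally have u: "u < 1" "u > 0" using True elim by auto
        have "(1 - u) powr (real m - 1) = (1 - u) ^ (m - 1)"
          using u m by (simp add: powr_realpow[symmetric] of_nat_diff)
        moreover have "u powr (real a + 1 - 1) = u ^ a" using u by (simp add: powr_realpow)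
        moreover have "(t - t * u) ^ (m - 1) = t ^ (m - 1) * (1 - u) ^ (m - 1)"
          by (simp add: right_diff_distrib flip: power_mult_distrib)
        moreover have "t ^ (a + m - 1) = t ^ a * t ^ (m - 1)" using m by (simp flip: power_add)
        moreover have "t * u \<in> {0..x}" using True t by (simp add: field_simps)
        ultimately show ?thesis using True by (simp add: power_mult_distrib)
      next
        case False
        then have "t * u \<notin> {0..x}" using t by (auto simp: field_simps zero_le_mult_iff)
        then show ?thesis using False by simp
      qed
    qed
  qed auto
  also have "\<dots> = t ^ (a + m - 1) * (Beta (real a + 1) (real m) * reg_inc_beta (x / t) (real a + 1) (real m))"
  proof -
    \<comment> \<open>Positivity lets the normalizing factor of \<open>reg_inc_beta\<close>
      cancel.\<close>
    have "Beta (real a + 1) (real m) > 0"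
      using m unfolding Beta_def by (intro divide_pos_pos mult_pos_pos Gamma_real_pos) auto
    then show ?thesis by (simp add: reg_inc_beta_def set_lebesgue_integral_def)
  qed
  finally show ?thesis
    using m by (simp add: mult.assoc power_eq_if)
qed

text \<open>Integrate term by term: in the factor \<open>1 + y\<close>, the summand 1 produces
  \<open>Beta 1 m = 1 / m\<close> and the summand \<open>y\<close> produces
  \<open>Beta 2 m = 1 / (m * (m + 1))\<close>, with \<open>m = 2 * n - 2 - k\<close>.\<close>

lemma cdf_estimate_set_integral:
  assumes n: "n \<ge> 2" and x: "0 < x" "x < t"
  shows "cdf_estimate n x t = (LBINT y:{0..x}. pdf_estimate n y t)"
proof -
  have int: "set_integrable lborel {0..x} (\<lambda>y. y ^ a * (t - y) ^ l)" for a l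
    unfolding set_integrable_def
    by (intro borel_integrable_compact continuous_intros) auto
  have beta: "(LBINT y:{0..x}. (1 + y) * (t - y) ^ (2 * n - 3 - k)) = t ^ (2 * n - 2 - k) *
      (1 / (2 * real n - real k - 2) * reg_inc_beta (x / t) 1 (2 * real n - 2 - real k)
       + t * (1 / ((2 * real n - real k - 1) * (2 * real n - real k - 2)))
           * reg_inc_beta (x / t) 2 (2 * real n - 2 - real k))" if k: "k \<le> n - 1" for k
  proof -
    define m where "m = 2 * n - 2 - k"
    have m: "m \<ge> 1" "2 * n - 3 - k = m - 1" and mr: "2 * real n - 2 - real k = real m"
      "2 * real n - real k - 2 = real m" "2 * real n - real k - 1 = real m + 1"
      using n k by (auto simp: m_def)
    have "(LBINT y:{0..x}. (1 + y) * (t - y) ^ (m - 1)) =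
        (LBINT y:{0..x}. y ^ 0 * (t - y) ^ (m - 1) + y ^ 1 * (t - y) ^ (m - 1))"
      by (simp add: algebra_simps)
    also have "\<dots> = (LBINT y:{0..x}. y ^ 0 * (t - y) ^ (m - 1)) + (LBINT y:{0..x}. y ^ 1 * (t - y) ^ (m - 1))"
      by (rule set_integral_add(2)[OF int int])
    also have "\<dots> = t ^ m * Beta 1 (real m) * reg_inc_beta (x / t) 1 (real m) +
        t ^ (1 + m) * Beta 2 (real m) * reg_inc_beta (x / t) 2 (real m)"
      unfolding set_integral_power_mult_reg_inc_beta[OF x m(1)] by simp
    finally show ?thesis
      unfolding m(2) mr m_def[symmetric] Beta_nat_1[OF m(1)] Beta_nat_2[OF m(1)]
      by (simp add: algebra_simps)
  qed
  have "(LBINT y:{0..x}. pdf_estimate n y t) =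
      (LBINT y:{0..x}. \<Sum>k=0..n-1. 1 / A_fun n t * C_coeff k n * ((1 + y) * (t - y) ^ (2 * n - 3 - k)))"
    using x by (intro set_lebesgue_integral_cong) (auto simp: pdf_estimate_def sum_distrib_left sum_divide_distrib add_divide_distrib algebra_simps)
  also have "\<dots> = (\<Sum>k=0..n-1. LBINT y:{0..x}. 1 / A_fun n t * C_coeff k n * ((1 + y) * (t - y) ^ (2 * n - 3 - k)))"
    unfolding set_lebesgue_integral_def scaleR_sum_right
    by (intro Bochner_Integration.integral_sum borel_integrable_compact continuous_intros) auto
  also have "\<dots> = (\<Sum>k=0..n-1. 1 / A_fun n t * C_coeff k n * (LBINT y:{0..x}. (1 + y) * (t - y) ^ (2 * n - 3 - k)))"
    by simp
  also have "\<dots> = cdf_estimate n x t"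
    unfolding cdf_estimate_def if_P[OF x(2)] sum_distrib_left
    by (intro sum.cong refl, subst beta) (simp_all add: mult.assoc)
  finally show ?thesis by simp
qed

text \<open>For \<open>t \<le> x\<close> the default value 1 is the right one: the density estimate
  vanishes from \<open>t\<close> on, so the integral up to \<open>x\<close> is already the total
  mass.\<close>

lemma cdf_estimate_nn_integral:
  assumes n: "n \<ge> 2" and x: "x > 0" and t: "t > 0"
  shows "ennreal (cdf_estimate n x t) = (\<integral>\<^sup>+y. ennreal (pdf_estimate n y t) * indicator {0<..x} y \<partial>lborel)"
proof (cases "x < t")
  case True
  have "continuous_on {0..x} (\<lambda>y. (1 + y) / A_fun n t * (\<Sum>k=0..n-1. C_coeff k n * (t - y) ^ (2 * n - 3 - k)))"
    using A_fun_pos[of n t] n t by (intro continuous_intros) auto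
  then have "continuous_on {0..x} (\<lambda>y. pdf_estimate n y t)"
    using True by (subst continuous_on_cong[OF refl]) (auto simp: pdf_estimate_def)
  then have int: "integrable lborel (\<lambda>y. indicator {0..x} y *\<^sub>R pdf_estimate n y t)"
    by (intro borel_integrable_compact) auto
  have "ennreal (cdf_estimate n x t) = (\<integral>\<^sup>+y. ennreal (indicator {0..x} y *\<^sub>R pdf_estimate n y t) \<partial>lborel)"
    unfolding cdf_estimate_set_integral[OF n x True] set_lebesgue_integral_def
    by (rule nn_integral_eq_integral[symmetric, OF int])
       (auto split: split_indicator intro!: pdf_estimate_nonneg n)
  also have "\<dots> = (\<integral>\<^sup>+y. ennreal (pdf_estimate n y t) * indicator {0<..x} y \<partial>lborel)"
    \<comment> \<open>The endpoint 0, included to have a compact interval, is a null set.\<close>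
    using AE_lborel_singleton[of "0::real"]
    by (intro nn_integral_cong_AE) (auto elim!: eventually_mono split: split_indicator)
  finally show ?thesis .
next
  case False
  then have "(\<integral>\<^sup>+y. ennreal (pdf_estimate n y t) * indicator {0<..x} y \<partial>lborel) =
      (\<integral>\<^sup>+y. ennreal (pdf_estimate n y t) * indicator {0<..} y \<partial>lborel)"
    by (intro nn_integral_cong) (auto simp: pdf_estimate_def split: split_indicator)
  then show ?thesis
    using False nn_integral_pdf_estimate[OF n t] by (simp add: cdf_estimate_def)
qed

lemma cdf_estimate_bounds:
  assumes n: "n \<ge> 2" and x: "x > 0"
  shows "cdf_estimate n x t \<ge> 0" "cdf_estimate n x t \<le> 1"
proof -
  show "cdf_estimate n x t \<ge> 0"
  proof (cases "x < t")
    case True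
    then show ?thesis
      unfolding cdf_estimate_set_integral[OF n x True] set_lebesgue_integral_def
      by (intro integral_nonneg_AE AE_I2) (auto split: split_indicator intro!: pdf_estimate_nonneg n)
  qed (simp add: cdf_estimate_def)
  show "cdf_estimate n x t \<le> 1"
  proof (cases "x < t")
    case True
    then have t: "t > 0" using x by simp
    have "ennreal (cdf_estimate n x t) \<le> (\<integral>\<^sup>+y. ennreal (pdf_estimate n y t) * indicator {0<..} y \<partial>lborel)"
      unfolding cdf_estimate_nn_integral[OF n x t] by (intro nn_integral_mono) (auto split: split_indicator)
    then show ?thesis unfolding nn_integral_pdf_estimate[OF n t] by simp
  qed (simp add: cdf_estimate_def)
qed

text \<open>The variable upper limit is moved into the integrand, which is then jointly measurable
  in \<open>y\<close> and \<open>u\<close>.\<close>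

lemma borel_measurable_reg_inc_beta [measurable]:
  assumes [measurable]: "f \<in> borel_measurable M"
  shows "(\<lambda>w. reg_inc_beta (f w) \<alpha> \<beta>) \<in> borel_measurable M"
proof -
  have "(\<lambda>y. LBINT u:{0..y}. u powr (\<alpha> - 1) * (1 - u) powr (\<beta> - 1)) =
      (\<lambda>y. LBINT u. (if 0 \<le> u \<and> u \<le> y then u powr (\<alpha> - 1) * (1 - u) powr (\<beta> - 1) else 0))"
    unfolding set_lebesgue_integral_def by (intro ext Bochner_Integration.integral_cong) auto
  also have "\<dots> \<in> borel_measurable borel" by measurable
  finally have "(\<lambda>y. reg_inc_beta y \<alpha> \<beta>) \<in> borel_measurable borel"
    unfolding reg_inc_beta_def by measurable
  then show ?thesis by measurable
qed

lemma borel_measurable_cdf_estimate [measurable]: "cdf_estimate n x \<in> borel_measurable borel"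
  unfolding cdf_estimate_def by measurable

section \<open>The Lindley distribution function and its unbiased estimation\<close>

lemma lindley_cdf_nonneg:
  assumes "\<theta> > 0" shows "lindley_cdf \<theta> x \<ge> 0"
proof (cases "x > 0")
  case True
  have "(1 + \<theta> + \<theta> * x) / (1 + \<theta>) \<le> 1 + \<theta> * x"
    using assms True by (simp add: divide_le_eq algebra_simps)
  also have "\<dots> \<le> exp (\<theta> * x)" by (rule exp_ge_add_one_self)
  finally have "(1 + \<theta> + \<theta> * x) / (1 + \<theta>) * exp (- \<theta> * x) \<le> exp (\<theta> * x) * exp (- \<theta> * x)"
    by (intro mult_right_mono) auto
  then show ?thesis by (simp add: lindley_cdf_def flip: exp_add)
qed (simp add: lindley_cdf_def)

lemma nn_integral_lindley_pdf:
  assumes \<theta>: "\<theta> > 0" and x: "x > 0"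
  shows "(\<integral>\<^sup>+y. ennreal (lindley_pdf \<theta> y) * indicator {0<..x} y \<partial>lborel) = ennreal (lindley_cdf \<theta> x)"
proof -
  define c where "c = \<theta>\<^sup>2 / (1 + \<theta>)"
  have "c * (1 + \<theta>) = \<theta>\<^sup>2" using \<theta> by (simp add: c_def)
  \<comment> \<open>This identity reduces the derivative of \<open>F\<close> below to
    \<open>c * (1 + y) * exp (- \<theta> * y)\<close>.\<close>
  then have c: "c / \<theta> = \<theta> - c" using \<theta> by (simp add: field_simps power2_eq_square)
  \<comment> \<open>The distribution function minus 1 on the positive axis, as
    \<open>c / \<theta> = \<theta> / (1 + \<theta>)\<close>.\<close>
  define F where "F y = - ((1 + c / \<theta> * y) * exp (- \<theta> * y))" for y
  have "(\<integral>\<^sup>+y. ennreal (lindley_pdf \<theta> y) * indicator {0<..x} y \<partial>lborel) =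
      (\<integral>\<^sup>+y. ennreal (\<theta>\<^sup>2 / (1 + \<theta>) * (1 + y) * exp (- \<theta> * y)) * indicator {0..x} y \<partial>lborel)"
    using AE_lborel_singleton[of "0::real"]
    by (intro nn_integral_cong_AE) (auto elim!: eventually_mono split: split_indicator simp: lindley_pdf_def)
  also have "\<dots> = ennreal (F x - F 0)"
  proof (rule nn_integral_FTC_Icc)
    fix y
    show "(F has_real_derivative \<theta>\<^sup>2 / (1 + \<theta>) * (1 + y) * exp (- \<theta> * y)) (at y)"
    proof -
      have "(F has_real_derivative - (c / \<theta> * exp (- \<theta> * y) - \<theta> * exp (- \<theta> * y) * (1 + c / \<theta> * y)))
          (at y)"
        unfolding F_def using \<theta> by (auto intro!: derivative_eq_intros)
      also have "- (c / \<theta> * exp (- \<theta> * y) - \<theta> * exp (- \<theta> * y) * (1 + c / \<theta> * y)) =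
          (\<theta> - c / \<theta>) * exp (- \<theta> * y) + c * y * exp (- \<theta> * y)"
        using \<theta> by (simp add: algebra_simps)
      also have "\<dots> = \<theta>\<^sup>2 / (1 + \<theta>) * (1 + y) * exp (- \<theta> * y)"
        unfolding c by (simp add: c_def[symmetric] algebra_simps)
      finally show ?thesis .
    qed
    show "0 \<le> \<theta>\<^sup>2 / (1 + \<theta>) * (1 + y) * exp (- \<theta> * y)" if "y \<in> {0..x}" using \<theta> that by simp
  qed (use x in auto)
  also have "F x - F 0 = lindley_cdf \<theta> x"
  proof -
    have "(1 + \<theta> + \<theta> * x) / (1 + \<theta>) = 1 + c / \<theta> * x"
      using \<theta> by (simp add: c_def power2_eq_square add_divide_distrib)
    then show ?thesis using x by (simp add: F_def lindley_cdf_def)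
  qed
  finally show ?thesis .
qed

text \<open>Write the estimator as an integral of density estimates, exchange the integrals, and use
  unbiasedness at each point of \<open>(0, x]\<close>.\<close>

lemma nn_integral_lindley_sum_pdf_cdf_estimate:
  assumes n: "n \<ge> 2" and x: "x > 0" and \<theta>: "\<theta> > 0"
    and total: "(\<integral>\<^sup>+t. ennreal (lindley_sum_pdf (n - 1) \<theta> t) \<partial>lborel) = 1"
  shows "(\<integral>\<^sup>+t. ennreal (lindley_sum_pdf n \<theta> t) * ennreal (cdf_estimate n x t) \<partial>lborel) = ennreal (lindley_cdf \<theta> x)"
proof -
  have "(\<integral>\<^sup>+t. ennreal (lindley_sum_pdf n \<theta> t) * ennreal (cdf_estimate n x t) \<partial>lborel) =
      (\<integral>\<^sup>+t. (\<integral>\<^sup>+y. ennreal (lindley_sum_pdf n \<theta> t) * (ennreal (pdf_estimate n y t) * indicator {0<..x} y) \<partial>lborel) \<partial>lborel)"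
  \<comment> \<open>The integral representation requires \<open>t > 0\<close>; for
    \<open>t < 0\<close> the weight vanishes, and \<open>t = 0\<close> is a null set.\<close>
  proof (intro nn_integral_cong_AE eventually_mono[OF AE_lborel_singleton[of "0::real"]])
    fix t :: real assume elim: "t \<noteq> 0"
    show "ennreal (lindley_sum_pdf n \<theta> t) * ennreal (cdf_estimate n x t) =
        (\<integral>\<^sup>+y. ennreal (lindley_sum_pdf n \<theta> t) * (ennreal (pdf_estimate n y t) * indicator {0<..x} y) \<partial>lborel)"
    proof (cases "t > 0")
      case True
      then show ?thesis by (simp add: cdf_estimate_nn_integral n x nn_integral_cmult)
    next
      case False
      then show ?thesis using elim by (simp add: lindley_sum_pdf_def)
    qed
  qed
  also have "\<dots> = (\<integral>\<^sup>+y. (\<integral>\<^sup>+t. ennreal (lindley_sum_pdf n \<theta> t) * (ennreal (pdf_estimate n y t) * indicator {0<..x} y) \<partial>lborel) \<partial>lborel)"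
    by (rule lborel_pair.Fubini') simp
  also have "\<dots> = (\<integral>\<^sup>+y. ennreal (lindley_pdf \<theta> y) * indicator {0<..x} y \<partial>lborel)"
    using nn_integral_lindley_sum_pdf_pdf_estimate[OF n _ \<theta> total]
    by (intro nn_integral_cong) (auto split: split_indicator)
  also have "\<dots> = ennreal (lindley_cdf \<theta> x)" by (rule nn_integral_lindley_pdf[OF \<theta> x])
  finally show ?thesis .
qed

section \<open>Minimal variance\<close>

text \<open>Boxes determine a measure on the product, and on a box the integral of the product
  density factorizes. This yields the likelihood ratio of the whole sample.\<close>

lemma PiM_density:
  fixes g :: "'i \<Rightarrow> 'a \<Rightarrow> real"
  assumes I: "finite I" and M: "\<And>i. prob_space (M i)"
    and g[measurable]: "\<And>i. g i \<in> borel_measurable (M i)" and g0: "\<And>i y. g i y \<ge> 0"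
    and N: "\<And>i. prob_space (density (M i) (g i))"
  shows "PiM I (\<lambda>i. density (M i) (g i)) = density (PiM I M) (\<lambda>s. ennreal (\<Prod>i\<in>I. g i (s i)))"
proof -
  interpret M: product_prob_space M I
    by (intro product_prob_spaceI M)
  interpret N: product_prob_space "\<lambda>i. density (M i) (g i)" I
    by (intro product_prob_spaceI N)
  show ?thesis
  proof (rule N.PiM_eqI[OF I, symmetric])
    show "sets (density (PiM I M) (\<lambda>s. ennreal (\<Prod>i\<in>I. g i (s i)))) = sets (PiM I (\<lambda>i. density (M i) (g i)))"
      by (simp cong: sets_PiM_cong)
    fix A assume "\<And>i. i \<in> I \<Longrightarrow> A i \<in> sets (density (M i) (g i))"
    then have A[measurable]: "i \<in> I \<Longrightarrow> A i \<in> sets (M i)" for i by simp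
    have "Pi\<^sub>E I A \<in> sets (PiM I M)" using I A by (intro sets_PiM_I_finite) auto
    moreover have "(\<lambda>s. ennreal (\<Prod>i\<in>I. g i (s i))) \<in> borel_measurable (PiM I M)" by measurable
    ultimately have "emeasure (density (PiM I M) (\<lambda>s. ennreal (\<Prod>i\<in>I. g i (s i)))) (Pi\<^sub>E I A) =
        (\<integral>\<^sup>+s. ennreal (\<Prod>i\<in>I. g i (s i)) * indicator (Pi\<^sub>E I A) s \<partial>PiM I M)"
      by (intro emeasure_density)
    also have "\<dots> = (\<integral>\<^sup>+s. (\<Prod>i\<in>I. ennreal (g i (s i)) * indicator (A i) (s i)) \<partial>PiM I M)"
    proof (intro nn_integral_cong)
      fix s assume "s \<in> space (PiM I M)"
      then have "indicator (Pi\<^sub>E I A) s = (\<Prod>i\<in>I. indicator (A i) (s i) :: ennreal)"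
        using I by (auto simp: space_PiM PiE_iff prod_zero_iff split: split_indicator)
      then show "ennreal (\<Prod>i\<in>I. g i (s i)) * indicator (Pi\<^sub>E I A) s =
          (\<Prod>i\<in>I. ennreal (g i (s i)) * indicator (A i) (s i))"
        using g0 by (simp add: prod.distrib prod_ennreal)
    qed
    also have "\<dots> = (\<Prod>i\<in>I. \<integral>\<^sup>+y. ennreal (g i y) * indicator (A i) y \<partial>M i)"
      using I by (intro M.product_nn_integral_prod) auto
    also have "\<dots> = (\<Prod>i\<in>I. emeasure (density (M i) (g i)) (A i))"
      by (intro prod.cong) (auto simp: emeasure_density)
    finally show "emeasure (density (PiM I M) (\<lambda>s. ennreal (\<Prod>i\<in>I. g i (s i)))) (Pi\<^sub>E I A) =
        (\<Prod>i\<in>I. emeasure (density (M i) (g i)) (A i))" .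
  qed
qed

lemma (in prob_space) indep_set_commute: "indep_set A B \<Longrightarrow> indep_set B A"
  unfolding indep_sets2_eq by (metis Int_commute mult.commute)

lemma (in prob_space) indep_var_commute: "indep_var S X T Y \<Longrightarrow> indep_var T Y S X"
  unfolding indep_var_eq by (simp add: indep_set_commute)

text \<open>Exponential family structure: the factor \<open>1 + y\<close> is common to all
  parameters, so the ratio of densities is a constant times \<open>exp (- k * y)\<close>.\<close>

lemma lindley_pdf_shift:
  assumes "\<theta> > 0" "k \<ge> 0"
  shows "lindley_pdf (\<theta> + k) y =
    lindley_pdf \<theta> y * ((\<theta> + k)\<^sup>2 / (1 + (\<theta> + k)) / (\<theta>\<^sup>2 / (1 + \<theta>)) * exp (- k * y))"
proof (cases "y > 0")
  case True
  have "exp (- (\<theta> + k) * y) = exp (- \<theta> * y) * exp (- k * y)"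
    by (simp add: algebra_simps flip: exp_add)
  moreover have "\<theta> \<noteq> 0" "1 + \<theta> \<noteq> 0" using assms by auto
  ultimately show ?thesis using True by (simp add: lindley_pdf_def)
qed (simp add: lindley_pdf_def)

section \<open>The sample, its law and the optimality of bounded functions of the sum\<close>

locale lindley_sample =
  fixes P :: "real \<Rightarrow> 'a measure" and X :: "nat \<Rightarrow> 'a \<Rightarrow> real" and n :: nat
  assumes n: "n \<ge> 2"
    and P: "\<theta> > 0 \<Longrightarrow> prob_space (P \<theta>)"
    and indep: "\<theta> > 0 \<Longrightarrow> prob_space.indep_vars (P \<theta>) (\<lambda>_. borel) X {1..n}"
    and X: "\<theta> > 0 \<Longrightarrow> i \<in> {1..n} \<Longrightarrow> distributed (P \<theta>) lborel (X i) (\<lambda>y. ennreal (lindley_pdf \<theta> y))"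
begin

abbreviation S :: "(nat \<Rightarrow> real) measure" where
  "S \<equiv> Pi\<^sub>M {1..n} (\<lambda>_. borel)"

text \<open>The measures \<open>P \<theta>\<close> are not related to each other on their own
  spaces; their images on the sample space can be compared by densities.\<close>

definition law :: "real \<Rightarrow> (nat \<Rightarrow> real) measure" where
  "law \<theta> = distr (P \<theta>) S (sample n X)"

lemma sample_sum: "(\<Sum>i=Suc 0..n. sample n X \<omega> i) = (\<Sum>i=Suc 0..n. X i \<omega>)"
  by (simp add: sample_def)

lemma X_measurable: "\<theta> > 0 \<Longrightarrow> i \<in> {1..n} \<Longrightarrow> X i \<in> borel_measurable (P \<theta>)"
  using distributed_measurable[OF X] by simp

lemma sample_measurable: "\<theta> > 0 \<Longrightarrow> sample n X \<in> measurable (P \<theta>) S"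
  unfolding sample_def[abs_def] using X_measurable by (intro measurable_restrict) auto

text \<open>Induction on \<open>m\<close>: the next observation is independent of the partial sum,
  so the densities convolve. Besides \<open>m = n\<close>, the case \<open>m = n - 1\<close> is used
  for normalization.\<close>

lemma distributed_sum:
  assumes \<theta>: "\<theta> > 0" and m: "1 \<le> m" "m \<le> n"
  shows "distributed (P \<theta>) lborel (\<lambda>\<omega>. \<Sum>i=1..m. X i \<omega>) (\<lambda>t. ennreal (lindley_sum_pdf m \<theta> t))"
  using m
proof (induction m rule: dec_induct)
  case base
  have "distributed (P \<theta>) lborel (X 1) (\<lambda>t. ennreal (lindley_sum_pdf 1 \<theta> t))"
    by (subst distributed_cong_density[where g = "\<lambda>y. ennreal (lindley_pdf \<theta> y)"])
       (use X[OF \<theta>, of 1] n in \<open>auto simp: lindley_pdf_eq_sum_pdf intro: eventually_mono[OF AE_lborel_singleton[of 0]]\<close>)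
  then show ?case by simp
next
  case (step m)
  interpret prob_space "P \<theta>" by (rule P[OF \<theta>])
  have "indep_vars (\<lambda>_. borel) X (insert (Suc m) {1..m})"
    using indep_vars_subset[OF indep[OF \<theta>]] step by auto
  then have "indep_var borel (X (Suc m)) borel (\<lambda>\<omega>. \<Sum>i=1..m. X i \<omega>)"
    by (intro indep_vars_sum) auto
  then have "indep_var borel (\<lambda>\<omega>. \<Sum>i=1..m. X i \<omega>) borel (X (Suc m))"
    by (rule indep_var_commute)
  from distributed_convolution[OF this step.IH X[OF \<theta>]] step
  show ?case
    by (simp add: lindley_convolution[OF _ \<theta>])
qed

lemma nn_integral_sum_pdf:
  assumes \<theta>: "\<theta> > 0" and m: "1 \<le> m" "m \<le> n"
  shows "(\<integral>\<^sup>+t. ennreal (lindley_sum_pdf m \<theta> t) \<partial>lborel) = 1"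
proof -
  interpret prob_space "P \<theta>" by (rule P[OF \<theta>])
  show ?thesis
    using distributed_nn_integral[OF distributed_sum[OF assms], of "\<lambda>_. 1"] by (simp add: emeasure_space_1)
qed

text \<open>The density of the sum vanishes on negative numbers. This puts \<open>exp (- T)\<close>
  into the unit interval almost everywhere.\<close>

lemma sum_nonneg_AE:
  assumes \<theta>: "\<theta> > 0"
  shows "AE s in law \<theta>. (\<Sum>i=1..n. s i) \<ge> 0"
proof -
  have "AE \<omega> in P \<theta>. (\<Sum>i=1..n. X i \<omega>) \<ge> 0"
  proof -
    have d: "distributed (P \<theta>) lborel (\<lambda>\<omega>. \<Sum>i=1..n. X i \<omega>) (\<lambda>t. ennreal (lindley_sum_pdf n \<theta> t))"
      using n by (intro distributed_sum \<theta>) auto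
    have "AE t in density lborel (\<lambda>t. ennreal (lindley_sum_pdf n \<theta> t)). t \<ge> 0"
      by (subst AE_density) (auto simp: lindley_sum_pdf_def intro!: AE_I2)
    then show ?thesis
      unfolding distributed_distr_eq_density[OF d, symmetric]
      by (subst (asm) AE_distr_iff[OF distributed_measurable[OF d]]) auto
  qed
  then show ?thesis
    unfolding law_def by (subst AE_distr_iff[OF sample_measurable[OF \<theta>]]) (simp_all add: sample_sum)
qed

text \<open>Independence makes the law a product, so the one-observation ratios multiply to a
  function of the sum alone. This is where sufficiency enters.\<close>

lemma law_shift:
  assumes \<theta>: "\<theta> > 0" and k: "k \<ge> 0"
  obtains K where "K > 0" "law (\<theta> + k) = density (law \<theta>) (\<lambda>s. ennreal (K * exp (- k * (\<Sum>i=1..n. s i))))"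
proof -
  \<comment> \<open>The ratio of the normalizing constants at \<open>\<theta> + k\<close> and
    \<open>\<theta>\<close>; the constant \<open>K\<close> becomes \<open>C ^ n\<close>.\<close>
  define C where "C = (\<theta> + k)\<^sup>2 / (1 + (\<theta> + k)) / (\<theta>\<^sup>2 / (1 + \<theta>))"
  have C: "C > 0" using \<theta> k by (simp add: C_def)
  have law_PiM: "law \<eta> = PiM {1..n} (\<lambda>_. density lborel (\<lambda>y. ennreal (lindley_pdf \<eta> y)))" if \<eta>: "\<eta> > 0" for \<eta>
  proof -
    interpret prob_space "P \<eta>" by (rule P[OF \<eta>])
    have "law \<eta> = PiM {1..n} (\<lambda>i. distr (P \<eta>) borel (X i))"
      unfolding law_def sample_def[abs_def]
      using indep[OF \<eta>] X_measurable[OF \<eta>] n by (subst indep_vars_iff_distr_eq_PiM'[symmetric]) auto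
    also have "\<dots> = PiM {1..n} (\<lambda>_. density lborel (\<lambda>y. ennreal (lindley_pdf \<eta> y)))"
    proof (intro PiM_cong refl)
      fix i assume "i \<in> {1..n}"
      then have "distr (P \<eta>) lborel (X i) = density lborel (\<lambda>y. ennreal (lindley_pdf \<eta> y))"
        by (intro distributed_distr_eq_density X \<eta>)
      moreover have "distr (P \<eta>) borel (X i) = distr (P \<eta>) lborel (X i)" by (intro distr_cong) auto
      ultimately show "distr (P \<eta>) borel (X i) = density lborel (\<lambda>y. ennreal (lindley_pdf \<eta> y))" by simp
    qed
    finally show ?thesis .
  qed
  have prob: "prob_space (density lborel (\<lambda>y. ennreal (lindley_pdf \<eta> y)))" if \<eta>: "\<eta> > 0" for \<eta>
  proof -
    interpret prob_space "P \<eta>" by (rule P[OF \<eta>])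
    show ?thesis using X[OF \<eta>, of 1] n
      by (subst distributed_distr_eq_density[symmetric]) (auto intro!: prob_space_distr dest: distributed_measurable)
  qed
  define M where "M = density lborel (\<lambda>y. ennreal (lindley_pdf \<theta> y))"
  have shift: "density lborel (\<lambda>y. ennreal (lindley_pdf (\<theta> + k) y)) = density M (\<lambda>y. ennreal (C * exp (- k * y)))"
  proof -
    have "lindley_pdf (\<theta> + k) y = lindley_pdf \<theta> y * (C * exp (- k * y))" for y
      unfolding C_def by (rule lindley_pdf_shift[OF \<theta> k])
    then show ?thesis
      unfolding M_def using \<theta> C
      by (subst density_density_eq) (auto simp: lindley_pdf_nonneg ennreal_mult)
  qed
  have "law (\<theta> + k) = PiM {1..n} (\<lambda>_. density M (\<lambda>y. ennreal (C * exp (- k * y))))"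
    using \<theta> k by (simp add: law_PiM shift)
  also have "\<dots> = density (PiM {1..n} (\<lambda>_. M)) (\<lambda>s. ennreal (\<Prod>i=1..n. C * exp (- k * s i)))"
  proof (rule PiM_density)
    show "prob_space M" unfolding M_def by (rule prob[OF \<theta>])
    show "prob_space (density M (\<lambda>y. ennreal (C * exp (- k * y))))"
      unfolding shift[symmetric] using \<theta> k by (intro prob) simp
  qed (use C in \<open>auto simp: M_def\<close>)
  also have "(\<lambda>s. ennreal (\<Prod>i=1..n. C * exp (- k * s i))) = (\<lambda>s. ennreal (C ^ n * exp (- k * (\<Sum>i=1..n. s i))))"
  proof
    fix s :: "nat \<Rightarrow> real"
    have "exp (- k * (\<Sum>i=1..n. s i)) = (\<Prod>i=1..n. exp (- k * s i))"
      unfolding sum_distrib_left by (rule exp_sum) simp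
    then show "ennreal (\<Prod>i=1..n. C * exp (- k * s i)) = ennreal (C ^ n * exp (- k * (\<Sum>i=1..n. s i)))"
      by (simp only: prod.distrib) simp
  qed
  also have "PiM {1..n} (\<lambda>_. M) = law \<theta>" using \<theta> by (simp add: law_PiM M_def)
  finally show ?thesis using C that[of "C ^ n"] by simp
qed

text \<open>Vanishing expectation at \<open>\<theta> + k\<close>, rewritten by
  \<open>law_shift\<close>, says that the \<open>k\<close>-th moment of \<open>exp (- T)\<close>
  weighted by \<open>D\<close> vanishes at \<open>\<theta>\<close>. The moment argument then
  applies.\<close>

lemma sufficient_complete_orthogonal:
  fixes D :: "(nat \<Rightarrow> real) \<Rightarrow> real"
  assumes \<theta>: "\<theta> > 0"
    and D[measurable]: "D \<in> borel_measurable S"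
    and int: "\<And>\<eta>. \<eta> > 0 \<Longrightarrow> integrable (law \<eta>) D" and zero: "\<And>\<eta>. \<eta> > 0 \<Longrightarrow> integral\<^sup>L (law \<eta>) D = 0"
    and h[measurable]: "h \<in> borel_measurable borel" and bound: "\<And>t. \<bar>h t\<bar> \<le> B"
  shows "(\<integral>s. D s * h (\<Sum>i=1..n. s i) \<partial>law \<theta>) = 0"
proof -
  define Z where "Z s = exp (- (\<Sum>i=1..n. s i))" for s :: "nat \<Rightarrow> real"
  have sets_law[measurable_cong, simp]: "sets (law \<eta>) = sets S" for \<eta> by (simp add: law_def)
  have [measurable]: "Z \<in> borel_measurable S" unfolding Z_def by measurable
  have moments: "(\<integral>s. D s * Z s ^ k \<partial>law \<theta>) = 0" for k
  proof -
    obtain K where K: "K > 0" "law (\<theta> + real k) = density (law \<theta>) (\<lambda>s. ennreal (K * exp (- real k * (\<Sum>i=1..n. s i))))"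
      using law_shift[OF \<theta>, of "real k"] by auto
    have Z_power: "exp (- real k * (\<Sum>i=1..n. s i)) = Z s ^ k" for s
      unfolding Z_def exp_of_nat_mult[symmetric] by simp
    have "0 = (\<integral>s. D s \<partial>law (\<theta> + real k))" using zero[of "\<theta> + real k"] \<theta> by simp
    also have "\<dots> = (\<integral>s. (K * Z s ^ k) *\<^sub>R D s \<partial>law \<theta>)"
      unfolding K(2) Z_power using K(1) by (intro integral_density) (measurable, simp add: Z_def)
    also have "\<dots> = K * (\<integral>s. D s * Z s ^ k \<partial>law \<theta>)"
      by (simp add: mult_ac)
    finally show ?thesis using K(1) by simp
  qed
  have Z01: "AE s in law \<theta>. Z s \<in> {0..1}"
    using sum_nonneg_AE[OF \<theta>] by eventually_elim (simp add: Z_def)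
  \<comment> \<open>The sum is recovered exactly as \<open>- ln (Z s)\<close>, so \<open>h\<close>
    of the sum is a bounded Borel function of \<open>Z\<close>.\<close>
  have "(\<lambda>z. h (- ln z)) \<in> borel_measurable borel" by measurable
  from integral_mult_bounded_eq_0[OF int[OF \<theta>] _ Z01 moments this bound]
  have "(\<integral>s. D s * h (- ln (Z s)) \<partial>law \<theta>) = 0" by measurable
  then show ?thesis by (simp add: Z_def)
qed

text \<open>The difference to any competitor estimates 0 without bias and is therefore orthogonal to
  \<open>h\<close> of the sum. Boundedness of \<open>h\<close> makes that product integrable even
  when the competitor has no second moment.\<close>

lemma umvue_bounded:
  assumes h[measurable]: "h \<in> borel_measurable borel" and bound: "\<And>t. \<bar>h t\<bar> \<le> B"
    and unbiased: "\<And>\<theta>. \<theta> > 0 \<Longrightarrow> (\<integral>\<omega>. h (\<Sum>i=1..n. X i \<omega>) \<partial>P \<theta>) = g \<theta>"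
  shows "umvue {0<..} P (sample n X) S g (\<lambda>s. h (\<Sum>i=1..n. s i))"
proof -
  let ?d = "\<lambda>s::nat \<Rightarrow> real. h (\<Sum>i=1..n. s i)"
  have int: "integrable (P \<theta>) (\<lambda>\<omega>. ?d (sample n X \<omega>))" if \<theta>: "\<theta> > 0" for \<theta>
  proof -
    interpret prob_space "P \<theta>" by (rule P[OF \<theta>])
    show ?thesis
      using bound measurable_compose[OF sample_measurable[OF \<theta>], of ?d borel]
      by (intro integrable_const_bound[where B = B]) auto
  qed
  have d: "unbiased_estimator {0<..} P (sample n X) S g ?d"
    unfolding unbiased_estimator_def using int unbiased by (auto simp: sample_sum)
  show ?thesis
    unfolding umvue_def
  proof (intro conjI d allI impI ballI)
    fix d' and \<theta> :: real assume d': "unbiased_estimator {0<..} P (sample n X) S g d'" and "\<theta> \<in> {0<..}"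
    then have \<theta>: "\<theta> > 0" by simp
    have d'm[measurable]: "d' \<in> borel_measurable S"
      and d'int: "\<And>\<eta>. \<eta> > 0 \<Longrightarrow> integrable (P \<eta>) (\<lambda>\<omega>. d' (sample n X \<omega>))"
      and d'eq: "\<And>\<eta>. \<eta> > 0 \<Longrightarrow> (\<integral>\<omega>. d' (sample n X \<omega>) \<partial>P \<eta>) = g \<eta>"
      using d' by (auto simp: unbiased_estimator_def)
    have D: "(\<lambda>s. d' s - ?d s) \<in> borel_measurable S" by measurable
    have "(\<integral>s. (d' s - ?d s) * ?d s \<partial>law \<theta>) = 0"
    proof (rule sufficient_complete_orthogonal[OF \<theta> _ _ _ h bound])
      fix \<eta> :: real assume \<eta>: "\<eta> > 0"
      show "integrable (law \<eta>) (\<lambda>s. d' s - ?d s)"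
        unfolding law_def integrable_distr_eq[OF sample_measurable[OF \<eta>] D]
        using int[OF \<eta>] d'int[OF \<eta>] by simp
      show "(\<integral>s. d' s - ?d s \<partial>law \<eta>) = 0"
        unfolding law_def integral_distr[OF sample_measurable[OF \<eta>] D]
        using int[OF \<eta>] d'int[OF \<eta>] d'eq[OF \<eta>] unbiased[OF \<eta>] by (simp add: sample_sum)
    qed (rule D)
    moreover have m: "(\<lambda>s. (d' s - ?d s) * ?d s) \<in> borel_measurable S" by measurable
    ultimately have orth: "(\<integral>\<omega>. (d' (sample n X \<omega>) - ?d (sample n X \<omega>)) * ?d (sample n X \<omega>) \<partial>P \<theta>) = 0"
      unfolding law_def integral_distr[OF sample_measurable[OF \<theta>] m] by simp
    show "evariance (P \<theta>) (\<lambda>\<omega>. ?d (sample n X \<omega>)) \<le> evariance (P \<theta>) (\<lambda>\<omega>. d' (sample n X \<omega>))"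
      using int[OF \<theta>] d'int[OF \<theta>] d'eq[OF \<theta>] unbiased[OF \<theta>]
      by (intro evariance_le[where B = B] P[OF \<theta>] orth bound) (auto simp: sample_sum)
  qed
qed

text \<open>Carries the nonnegative integrals against the density of the sum over to expectations;
  \<open>c \<ge> 0\<close> matters because \<open>ennreal\<close> sends negative numbers to
  0.\<close>

lemma expectation_sum:
  assumes \<theta>: "\<theta> > 0" and h[measurable]: "h \<in> borel_measurable borel" and h0: "\<And>t. h t \<ge> 0"
    and I: "(\<integral>\<^sup>+t. ennreal (lindley_sum_pdf n \<theta> t) * ennreal (h t) \<partial>lborel) = ennreal c" and c: "c \<ge> 0"
  shows "(\<integral>\<omega>. h (\<Sum>i=1..n. X i \<omega>) \<partial>P \<theta>) = c"
proof -
  have [measurable]: "(\<lambda>\<omega>. \<Sum>i=1..n. X i \<omega>) \<in> borel_measurable (P \<theta>)"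
    using X_measurable[OF \<theta>] by (intro borel_measurable_sum) auto
  have "(\<integral>\<^sup>+\<omega>. ennreal (h (\<Sum>i=1..n. X i \<omega>)) \<partial>P \<theta>) = ennreal c"
    using distributed_nn_integral[OF distributed_sum[OF \<theta>], of n "\<lambda>t. ennreal (h t)"] n I by simp
  moreover have "(\<lambda>\<omega>. h (\<Sum>i=1..n. X i \<omega>)) \<in> borel_measurable (P \<theta>)" by measurable
  ultimately show ?thesis
    using h0 c by (subst integral_eq_nn_integral) auto
qed

lemma umvue_pdf_estimate:
  assumes x: "x > 0"
  shows "umvue {0<..} P (sample n X) S (\<lambda>\<theta>. lindley_pdf \<theta> x) (\<lambda>s. pdf_estimate n x (\<Sum>i=1..n. s i))"
proof -
  obtain B where B: "\<And>t. \<bar>pdf_estimate n x t\<bar> \<le> B" using pdf_estimate_bounded[OF n x] by blast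
  show ?thesis
  proof (rule umvue_bounded[OF _ B])
    fix \<theta> :: real assume \<theta>: "\<theta> > 0"
    show "(\<integral>\<omega>. pdf_estimate n x (\<Sum>i=1..n. X i \<omega>) \<partial>P \<theta>) = lindley_pdf \<theta> x"
      using n x by (intro expectation_sum[OF \<theta>] nn_integral_lindley_sum_pdf_pdf_estimate nn_integral_sum_pdf
          pdf_estimate_nonneg lindley_pdf_nonneg \<theta>) auto
  qed measurable
qed

lemma umvue_cdf_estimate:
  assumes x: "x > 0"
  shows "umvue {0<..} P (sample n X) S (\<lambda>\<theta>. lindley_cdf \<theta> x) (\<lambda>s. cdf_estimate n x (\<Sum>i=1..n. s i))"
proof (rule umvue_bounded[where B = 1])
  show "\<bar>cdf_estimate n x t\<bar> \<le> 1" for t using cdf_estimate_bounds[OF n x] by (simp add: abs_le_iff)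
  fix \<theta> :: real assume \<theta>: "\<theta> > 0"
  show "(\<integral>\<omega>. cdf_estimate n x (\<Sum>i=1..n. X i \<omega>) \<partial>P \<theta>) = lindley_cdf \<theta> x"
    using n x by (intro expectation_sum[OF \<theta>] nn_integral_lindley_sum_pdf_cdf_estimate nn_integral_sum_pdf
        cdf_estimate_bounds lindley_cdf_nonneg \<theta>) auto
qed measurable

end

theorem theorem3p1:
  fixes P :: "real \<Rightarrow> 'a measure" and X :: "nat \<Rightarrow> 'a \<Rightarrow> real" and n :: nat and x :: real
  assumes "n \<ge> 2"
    and "\<And>\<theta>. \<theta> > 0 \<Longrightarrow> prob_space (P \<theta>)"
    and "\<And>\<theta>. \<theta> > 0 \<Longrightarrow> prob_space.indep_vars (P \<theta>) (\<lambda>_. borel) X {1..n}"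
    and "\<And>\<theta> i. \<theta> > 0 \<Longrightarrow> i \<in> {1..n} \<Longrightarrow>
           distributed (P \<theta>) lborel (X i) (\<lambda>y. ennreal (lindley_pdf \<theta> y))"
    and "x > 0"
  shows "umvue {0<..} P (sample n X) (Pi\<^sub>M {1..n} (\<lambda>_. borel))
           (\<lambda>\<theta>. lindley_pdf \<theta> x) (\<lambda>s. pdf_estimate n x (\<Sum>i=1..n. s i))
       \<and> umvue {0<..} P (sample n X) (Pi\<^sub>M {1..n} (\<lambda>_. borel))
           (\<lambda>\<theta>. lindley_cdf \<theta> x) (\<lambda>s. cdf_estimate n x (\<Sum>i=1..n. s i))"
proof -
  interpret lindley_sample P X n by (intro lindley_sample.intro assms(1-4))
  show ?thesis using umvue_pdf_estimate umvue_cdf_estimate assms(5) by blast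
qed

end
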